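(* Let $\mathcal{T}_C$ be the weighted branching tree defined by the vector $(N,C_1,\dots,C_N)$ (see context), where $N\in\{0,1,2,\dots\}\cup\{\infty\}$ and the $C_i$ are real valued. For $n\in\{0,1,2,\dots\}$ and $\mathbf{i}\in A_n$ let $V_{\mathbf{i}}=\log|\Pi_{\mathbf{i}}|$ and $X_{\mathbf{i}}=\mathrm{sgn}(\Pi_{\mathbf{i}})$; $V_\emptyset\equiv0$, $X_\emptyset\equiv1$. For $\alpha>0$ define the measures $$\mu_n^{(+)}(dt)=e^{\alpha t}E\left[\sum_{\mathbf{i}\in A_n}1(X_{\mathbf{i}}=1,V_{\mathbf{i}}\in dt)\right],\qquad \mu_n^{(-)}(dt)=e^{\alpha t}E\left[\sum_{\mathbf{i}\in A_n}1(X_{\mathbf{i}}=-1,V_{\mathbf{i}}\in dt)\right],$$ for $n=0,1,2,\dots$, and let $\eta_\pm(dt)=\mu_1^{(\pm)}(dt)$. Suppose that $E\left[\sum_{i=1}^N|C_i|^\alpha\log|C_i|\right]\ge0$ and $E\left[\sum_{i=1}^N|C_i|^\alpha\right]=1$. Then $(\eta_++\eta_-)(\cdot)$ is a probability measure on $\mathbb{R}$ that places no mass at $-\infty$, and has mean $$\int_{-\infty}^\infty u\,\eta_+(du)+\int_{-\infty}^\infty u\,\eta_-(du)=E\left[\sum_{j=1}^N|C_j|^\alpha\log|C_j|\right].$$ Furthermore, if $\boldsymbol{\mu}_n=(\mu_n^{(+)},\mu_n^{(-)})$, $\mathbf{e}=(1,0)$ and $\mathbf{H}=\begin{pmatrix}\eta_+&\eta_-\\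 \eta_-&\eta_+\end{pmatrix}$, then $$\boldsymbol{\mu}_n=(\mu_n^{(+)},\mu_n^{(-)})=(1,0)\begin{pmatrix}\eta_+&\eta_-\\ \eta_-&\eta_+\end{pmatrix}^{*n}=\mathbf{e}\,\mathbf{H}^{*n},$$ where $\mathbf{H}^{*n}$ denotes the $n$th matrix convolution of $\mathbf{H}$ with itself.
   Context: Weighted branching tree $\mathcal{T}_C$. Let $U=\bigcup_{k=0}^\infty\{1,2,3,\dots\}^k$ be the set of finite sequences of positive integers, $\emptyset$ the empty sequence, and $(\mathbf{i},j)$ the concatenation of $\mathbf{i}\in U$ with $j$. Let $\{(N_{\mathbf{i}},C_{(\mathbf{i},1)},\dots,C_{(\mathbf{i},N_{\mathbf{i}})})\}_{\mathbf{i}\in U}$ be iid copies of $(N,C_1,\dots,C_N)$, the one at $\emptyset$ being $(N,C_1,\dots,C_N)$ itself. Set $A_0=\{\emptyset\}$ and $A_n=\{(\mathbf{i},j):\mathbf{i}\in A_{n-1},\ 1\le j\le N_{\mathbf{i}}\}$ for $n\ge1$ ($j$ a finite integer), and define weights $\Pi_\emptyset=1$, $\Pi_{(\mathbf{i},j)}=C_{(\mathbf{i},j)}\Pi_{\mathbf{i}}$. Matrix convolution: for $n\times n$ matrices $\mathbf{F}=(F_{ij})$, $\mathbf{G}=(G_{ij})$ of finite nonnegative measures on $\mathbb{R}$, $(\mathbf{F}*\mathbf{G})_{ij}=\sum_{k=1}^nF_{ik}*G_{kj}$, where $F_{ik}*G_{kj}$ is the convolution of measures; $\mathbf{F}^{*0}=\delta_0\mathbf{I}$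 ($\delta_0$ the point mass at $0$, $\mathbf{I}$ the identity matrix), $\mathbf{F}^{*1}=\mathbf{F}$, $\mathbf{F}^{*(k+1)}=\mathbf{F}^{*k}*\mathbf{F}$. Multiplication by the row vector $\mathbf{e}=(1,0)$ selects the first row. Conventions: $1(\cdot)$ is the indicator; $0^\alpha\log0=0$; sums $\sum_{i=1}^N$ run over all finite integers $1\le i\le N$. *)

theory Defs
  imports "HOL-Probability.Probability" "HOL-Library.Extended_Nat"
begin

section \<open>The weighted branching tree\<close>

definition nodes :: "nat list set" where
  "nodes = {i. \<forall>j\<in>set i. 1 \<le> j}"

text \<open>The indices \<open>1 \<le> j \<le> n\<close>; every \<open>j\<close> is finite, also if \<open>n = \<infinity>\<close>.\<close>

definition offspring :: "enat \<Rightarrow> nat set" where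
  "offspring n = {j. 1 \<le> j \<and> enat j \<le> n}"

text \<open>
  The vector \<open>(N\<^sub>i, C\<^sub>(\<^sub>i\<^sub>,\<^sub>1\<^sub>), \<dots>, C\<^sub>(\<^sub>i\<^sub>,\<^sub>N\<^sub>i\<^sub>))\<close> has random, possibly infinite length. It is encoded as \<open>N\<^sub>i\<close> together
  with an infinite sequence that is \<open>0\<close> beyond position \<open>N\<^sub>i\<close>, so that nothing is required of the
  values \<open>C\<^sub>(\<^sub>i\<^sub>,\<^sub>j\<^sub>)\<close> with \<open>j > N\<^sub>i\<close>.
\<close>

definition vec_space :: "(enat \<times> (nat \<Rightarrow> real)) measure" where
  "vec_space = count_space UNIV \<Otimes>\<^sub>M (\<Pi>\<^sub>M j\<in>{1..}. borel)"

definition node_vec ::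
  "(nat list \<Rightarrow> 'a \<Rightarrow> enat) \<Rightarrow> (nat list \<Rightarrow> 'a \<Rightarrow> real) \<Rightarrow> nat list \<Rightarrow> 'a \<Rightarrow> enat \<times> (nat \<Rightarrow> real)" where
  "node_vec N C i \<omega> = (N i \<omega>, \<lambda>j\<in>{1..}. if j \<in> offspring (N i \<omega>) then C (i @ [j]) \<omega> else 0)"

text \<open>
  The generic vector \<open>(N, C\<^sub>1, \<dots>, C\<^sub>N)\<close> is the one at the root, i.e.\ \<open>N []\<close> and \<open>C [j]\<close>.
  \<open>indep_vars\<close> includes the measurability of the vectors.
\<close>

locale weighted_branching_tree = prob_space M
  for M :: "'a measure" +
  fixes N :: "nat list \<Rightarrow> 'a \<Rightarrow> enat"
    and C :: "nat list \<Rightarrow> 'a \<Rightarrow> real"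
  assumes indep: "indep_vars (\<lambda>_. vec_space) (node_vec N C) nodes"
    and ident: "\<And>i. i \<in> nodes \<Longrightarrow>
      distr M vec_space (node_vec N C i) = distr M vec_space (node_vec N C [])"

primrec generation :: "(nat list \<Rightarrow> 'a \<Rightarrow> enat) \<Rightarrow> nat \<Rightarrow> 'a \<Rightarrow> nat list set" where
  "generation N 0 \<omega> = {[]}"
| "generation N (Suc n) \<omega> = {i @ [j] |i j. i \<in> generation N n \<omega> \<and> j \<in> offspring (N i \<omega>)}"

fun weight :: "(nat list \<Rightarrow> 'a \<Rightarrow> real) \<Rightarrow> nat list \<Rightarrow> 'a \<Rightarrow> real" where
  "weight C i \<omega> = (if i = [] then 1 else C i \<omega> * weight C (butlast i) \<omega>)"

declare weight.simps [simp del]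

lemma weight_Nil: "weight C [] \<omega> = 1"
  by (simp add: weight.simps)

lemma weight_snoc: "weight C (i @ [j]) \<omega> = C (i @ [j]) \<omega> * weight C i \<omega>"
  by (subst weight.simps) simp

section \<open>The measures \<open>\<mu>\<^sub>n\<close>\<close>

text \<open>The value \<open>V\<^sub>i = log \<bar>\<Pi>\<^sub>i\<bar>\<close> is extended real: it is \<open>-\<infinity>\<close> where \<open>\<Pi>\<^sub>i = 0\<close>.\<close>

definition log_weight :: "(nat list \<Rightarrow> 'a \<Rightarrow> real) \<Rightarrow> nat list \<Rightarrow> 'a \<Rightarrow> ereal" where
  "log_weight C i \<omega> = (if weight C i \<omega> = 0 then -\<infinity> else ereal (ln \<bar>weight C i \<omega>\<bar>))"

text \<open>The factor \<open>e\<^sup>\<alpha>\<^sup>t\<close> for \<open>\<alpha> > 0\<close>, on the extended line.\<close>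

definition exp_factor :: "real \<Rightarrow> ereal \<Rightarrow> ennreal" where
  "exp_factor \<alpha> t =
    (if t = -\<infinity> then 0 else if t = \<infinity> then \<infinity> else ennreal (exp (\<alpha> * real_of_ereal t)))"

definition intensity ::
  "'a measure \<Rightarrow> (nat list \<Rightarrow> 'a \<Rightarrow> enat) \<Rightarrow> (nat list \<Rightarrow> 'a \<Rightarrow> real) \<Rightarrow> real \<Rightarrow> nat \<Rightarrow> ereal measure" where
  "intensity M N C s n = measure_of UNIV (sets borel)
    (\<lambda>B. \<integral>\<^sup>+ \<omega>. (\<integral>\<^sup>+ i. of_bool (sgn (weight C i \<omega>) = s \<and> log_weight C i \<omega> \<in> B)
       \<partial>count_space (generation N n \<omega>)) \<partial>M)"

text \<open>
  With \<open>s = 1\<close> and \<open>s = -1\<close> these are the measures \<open>\<mu>\<^sub>n\<^sup>(\<^sup>+\<^sup>)\<close> and \<open>\<mu>\<^sub>n\<^sup>(\<^sup>-\<^sup>)\<close>: first on the extended line, where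
  the absence of mass at \<open>-\<infinity>\<close> can be expressed, then restricted to the real line.
\<close>

definition mu_ext ::
  "'a measure \<Rightarrow> (nat list \<Rightarrow> 'a \<Rightarrow> enat) \<Rightarrow> (nat list \<Rightarrow> 'a \<Rightarrow> real) \<Rightarrow> real \<Rightarrow> real \<Rightarrow> nat \<Rightarrow> ereal measure" where
  "mu_ext M N C \<alpha> s n = density (intensity M N C s n) (exp_factor \<alpha>)"

definition mu ::
  "'a measure \<Rightarrow> (nat list \<Rightarrow> 'a \<Rightarrow> enat) \<Rightarrow> (nat list \<Rightarrow> 'a \<Rightarrow> real) \<Rightarrow> real \<Rightarrow> real \<Rightarrow> nat \<Rightarrow> real measure" where
  "mu M N C \<alpha> s n =
    distr (restrict_space (mu_ext M N C \<alpha> s n) (range ereal)) borel real_of_ereal"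

section \<open>Sums of measures and matrix convolution\<close>

definition add_measure ::
  "'b::topological_space measure \<Rightarrow> 'b measure \<Rightarrow> 'b measure" where
  "add_measure F G = measure_of UNIV (sets borel) (\<lambda>B. emeasure F B + emeasure G B)"

definition sum_measure ::
  "('k \<Rightarrow> 'b::topological_space measure) \<Rightarrow> 'k set \<Rightarrow> 'b measure" where
  "sum_measure F K = measure_of UNIV (sets borel) (\<lambda>B. \<Sum>k\<in>K. emeasure (F k) B)"

definition mat_conv :: "real measure ^ 'n ^ 'n \<Rightarrow> real measure ^ 'n ^ 'n \<Rightarrow> real measure ^ 'n ^ 'n" where
  "mat_conv F G = (\<chi> i j. sum_measure (\<lambda>k. (F $ i $ k) \<star> (G $ k $ j)) UNIV)"

fun mat_conv_power :: "real measure ^ 'n ^ 'n \<Rightarrow> nat \<Rightarrow> real measure ^ 'n ^ 'n" where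
  "mat_conv_power F 0 = (\<chi> i j. if i = j then return borel 0 else null_measure borel)"
| "mat_conv_power F (Suc 0) = F"
| "mat_conv_power F (Suc (Suc k)) = mat_conv (mat_conv_power F (Suc k)) F"

definition row_times :: "ennreal ^ 'n \<Rightarrow> real measure ^ 'n ^ 'n \<Rightarrow> real measure ^ 'n" where
  "row_times e F = (\<chi> j. sum_measure (\<lambda>i. scale_measure (e $ i) (F $ i $ j)) UNIV)"

section \<open>Extended-real integrals\<close>

text \<open>
  The Lebesgue integral of an extended-real function as the difference of the integrals of the
  positive and negative parts. Since \<open>\<infinity> - \<infinity> = \<infinity>\<close> in type \<open>ereal\<close>, the value is meaningful
  only if one of the two parts is finite (\<open>ext_integrable\<close>). Over \<open>count_space A\<close> this is the sum
  over \<open>A\<close>.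
\<close>

definition ext_integrable :: "'b measure \<Rightarrow> ('b \<Rightarrow> ereal) \<Rightarrow> bool" where
  "ext_integrable M f \<longleftrightarrow> f \<in> borel_measurable M \<and>
    ((\<integral>\<^sup>+ x. e2ennreal (f x) \<partial>M) < \<infinity> \<or> (\<integral>\<^sup>+ x. e2ennreal (- f x) \<partial>M) < \<infinity>)"

definition ext_integral :: "'b measure \<Rightarrow> ('b \<Rightarrow> ereal) \<Rightarrow> ereal" where
  "ext_integral M f =
    enn2ereal (\<integral>\<^sup>+ x. e2ennreal (f x) \<partial>M) - enn2ereal (\<integral>\<^sup>+ x. e2ennreal (- f x) \<partial>M)"

end

theory Submission
  imports Defs
begin

text \<open>
  Let \<open>\<Theta>\<^sub>n\<close> be the measure on the real line given by
  \<open>\<integral> f d\<Theta>\<^sub>n = E [\<Sum>\<^sub>i \<bar>\<Pi>\<^sub>i\<bar>\<^sup>\<alpha> f(\<Pi>\<^sub>i)]\<close>, the sum running over the individuals \<open>i\<close> of generation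
  \<open>n\<close> (\<open>tilted_law\<close>). All assertions concern these signed weight laws, in two steps.

  First, the weight of a child is the weight of its parent times an independent copy of a coordinate
  of the generic vector, and the tilting factor \<open>\<bar>x\<bar>\<^sup>\<alpha>\<close> is multiplicative. Conditioning on the
  generations up to \<open>n\<close> therefore shows that \<open>\<Theta>\<^sub>n\<^sub>+\<^sub>1\<close> is the multiplicative convolution of \<open>\<Theta>\<^sub>n\<close>
  and \<open>\<Theta>\<^sub>1\<close> (\<open>nn_integral_tilted_law_Suc\<close>). As \<open>\<Theta>\<^sub>1\<close> has mass \<open>E [\<Sum>\<^sub>j \<bar>C\<^sub>j\<bar>\<^sup>\<alpha>] = 1\<close>, every \<open>\<Theta>\<^sub>n\<close> is a
  probability measure.

  Second, the multiplicative group of nonzero reals is \<open>{1, -1} \<times> \<real>\<close> by \<open>x \<mapsto> (sgn x, ln \<bar>x\<bar>)\<close>.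
  The measures \<open>\<mu>\<^sub>n\<^sup>(\<^sup>\<plusminus>\<^sup>)\<close> are the images under \<open>ln \<bar>x\<bar>\<close> of the restrictions of \<open>\<Theta>\<^sub>n\<close> to the two
  half-lines (\<open>mu_eq_signed_log\<close>), because \<open>e\<^sup>\<alpha>\<^sup>t = \<bar>x\<bar>\<^sup>\<alpha>\<close> at \<open>t = ln \<bar>x\<bar>\<close>. A product is positive
  iff the factors have equal signs, so a multiplicative convolution becomes a product with a
  symmetric \<open>2 \<times> 2\<close> matrix under additive convolution (\<open>signed_log_mult\<close>); induction on \<open>n\<close>
  gives \<open>\<^bold>\<mu>\<^sub>n = \<^bold>e \<^bold>H\<^sup>*\<^sup>n\<close>.

  Mass and mean of \<open>\<eta>\<^sub>+ + \<eta>\<^sub>-\<close> are integrals against \<open>\<Theta>\<^sub>1\<close>, that is, expectations of sums over the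
  first generation (\<open>nn_integral_mu_1\<close>). The positive and the negative part of the
  mean are computed separately; as one of them is finite, their difference does not depend on
  whether it is taken inside or outside the expectation (\<open>ext_integral_diff\<close>).
\<close>

section \<open>Sums of Borel measures\<close>

text \<open>
  A set function defined by a formula is the measure \<open>\<nu>\<close> as soon as it agrees with \<open>\<nu>\<close> on Borel
  sets; this spares a separate proof of countable additivity. Off the Borel sets the two may differ.
\<close>

lemma measure_of_borel_eqI:
  fixes \<nu> :: "'b::topological_space measure"
  assumes "sets \<nu> = sets borel" and "\<And>B. B \<in> sets borel \<Longrightarrow> f B = emeasure \<nu> B"
  shows "measure_of UNIV (sets borel) f = \<nu>"
proof -
  have sp: "space \<nu> = UNIV"
    using sets_eq_imp_space_eq[OF assms(1)] by simp
  have "measure_of UNIV (sets borel) f = measure_of UNIV (sets borel) (emeasure \<nu>)"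
    by (rule measure_of_eq) (use assms(2) sets.sigma_sets_eq[of "borel :: 'b measure"] in auto)
  also have "\<dots> = measure_of (space \<nu>) (sets \<nu>) (emeasure \<nu>)"
    by (simp add: sp assms(1))
  finally show ?thesis
    by (simp add: measure_of_of_measure)
qed

lemma sets_measure_of_borel [simp]: "sets (measure_of UNIV (sets borel) f) = sets borel"
  by (metis sets.sets_measure_of_eq space_borel)

lemma sets_sum_measure [simp, measurable_cong]: "sets (sum_measure F K) = sets borel"
  by (simp add: sum_measure_def)

lemma space_sum_measure [simp]: "space (sum_measure F K) = UNIV"
  using sets_eq_imp_space_eq[OF sets_sum_measure[of F K]] by simp

lemma emeasure_sum_measure:
  fixes F :: "'k \<Rightarrow> 'b::topological_space measure"
  assumes F: "\<And>k. k \<in> K \<Longrightarrow> sets (F k) = sets borel" and B: "B \<in> sets borel"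
  shows "emeasure (sum_measure F K) B = (\<Sum>k\<in>K. emeasure (F k) B)"
proof (rule emeasure_measure_of[OF sum_measure_def])
  show "countably_additive (sets (sum_measure F K)) (\<lambda>B. \<Sum>k\<in>K. emeasure (F k) B)"
  proof (rule countably_additiveI)
    fix A :: "nat \<Rightarrow> 'b set"
    assume A: "range A \<subseteq> sets (sum_measure F K)" "disjoint_family A"
    have "(\<Sum>i. \<Sum>k\<in>K. emeasure (F k) (A i)) = (\<Sum>k\<in>K. \<Sum>i. emeasure (F k) (A i))"
      by (rule suminf_sum) simp
    also have "\<dots> = (\<Sum>k\<in>K. emeasure (F k) (\<Union>i. A i))"
      using A F by (intro sum.cong refl suminf_emeasure) auto
    finally show "(\<Sum>i. \<Sum>k\<in>K. emeasure (F k) (A i)) = (\<Sum>k\<in>K. emeasure (F k) (\<Union>i. A i))" .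
  qed
qed (use B in \<open>auto simp: positive_def\<close>)

lemma add_measure_eq_sum_measure:
  "add_measure F G = sum_measure (\<lambda>b. if b then F else G) UNIV"
  by (simp add: add_measure_def sum_measure_def UNIV_bool add.commute)

lemma sets_add_measure [simp, measurable_cong]: "sets (add_measure F G) = sets borel"
  by (simp add: add_measure_eq_sum_measure)

lemma space_add_measure [simp]: "space (add_measure F G) = UNIV"
  by (simp add: add_measure_eq_sum_measure)

lemma emeasure_add_measure:
  assumes "sets F = sets borel" "sets G = sets borel" "B \<in> sets borel"
  shows "emeasure (add_measure F G) B = emeasure F B + emeasure G B"
  using assms by (simp add: add_measure_eq_sum_measure emeasure_sum_measure UNIV_bool add.commute)

lemma nn_integral_add_measure:
  assumes F: "sets F = sets borel" and G: "sets G = sets borel"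
    and f: "f \<in> borel_measurable borel"
  shows "(\<integral>\<^sup>+ x. f x \<partial>add_measure F G) = (\<integral>\<^sup>+ x. f x \<partial>F) + (\<integral>\<^sup>+ x. f x \<partial>G)"
  using f
proof (induction rule: borel_measurable_induct)
  case (cong f g)
  then show ?case by simp
next
  case (set A)
  then show ?case
    using F G by (simp add: emeasure_add_measure)
next
  case (mult u c)
  note [measurable] = mult(2) and [measurable_cong] = F G
  show ?case
    by (simp add: nn_integral_cmult mult distrib_left)
next
  case (add u v)
  note [measurable] = add(1,2,3,4,5) and [measurable_cong] = F G
  show ?case
    by (simp add: nn_integral_add add algebra_simps)
next
  case (seq U)
  note [measurable] = seq(1) and [measurable_cong] = F G
  have inc: "incseq (\<lambda>i. integral\<^sup>N P (U i))" for P
    using seq(3) by (auto simp: incseq_def le_fun_def intro!: nn_integral_mono)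
  have "(\<integral>\<^sup>+ x. (SUP i. U i x) \<partial>P) = (SUP i. integral\<^sup>N P (U i))" if "sets P = sets borel" for P
  proof -
    note [measurable_cong] = that
    show ?thesis
      by (rule nn_integral_monotone_convergence_SUP) (use seq(3) in auto)
  qed
  from this[OF F] this[OF G] this[of "add_measure F G"] seq.IH inc show ?case
    by (simp add: image_comp ennreal_SUP_add)
qed

section \<open>Extended-real integrals of differences\<close>

text \<open>
  The positive part \<open>p\<close> and the negative part \<open>q\<close> of \<open>a - b\<close> satisfy \<open>p + b = a + q\<close> wherever \<open>a\<close> or
  \<open>b\<close> is finite, hence almost everywhere. The integrated identity may be rearranged: with \<open>a\<close>
  also \<open>p \<le> a\<close> has a finite integral, and with \<open>b\<close> also \<open>q \<le> b\<close>, so that \<open>\<infinity> - \<infinity>\<close> occurs on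
  neither side.
\<close>

lemma ext_integral_diff:
  fixes a b :: "'b \<Rightarrow> ennreal"
  assumes [measurable]: "a \<in> borel_measurable P" "b \<in> borel_measurable P"
    and fin: "(\<integral>\<^sup>+ x. a x \<partial>P) < \<infinity> \<or> (\<integral>\<^sup>+ x. b x \<partial>P) < \<infinity>"
  shows "ext_integral P (\<lambda>x. enn2ereal (a x) - enn2ereal (b x)) =
    enn2ereal (\<integral>\<^sup>+ x. a x \<partial>P) - enn2ereal (\<integral>\<^sup>+ x. b x \<partial>P)"
proof -
  define p where "p x = e2ennreal (enn2ereal (a x) - enn2ereal (b x))" for x
  define q where "q x = e2ennreal (- (enn2ereal (a x) - enn2ereal (b x)))" for x
  have [measurable]: "p \<in> borel_measurable P" "q \<in> borel_measurable P"
    unfolding p_def q_def by measurable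
  have pt: "p x + b x = a x + q x \<and> p x \<le> a x \<and> q x \<le> b x" if "a x < \<infinity> \<or> b x < \<infinity>" for x
  proof (cases "a x"; cases "b x")
    fix r t
    assume "0 \<le> r" "a x = ennreal r" "0 \<le> t" "b x = ennreal t"
    then show ?thesis
      unfolding p_def q_def
      by (cases "r \<le> t") (auto simp: ennreal_plus[symmetric] ennreal_neg simp del: ennreal_plus)
  next
    fix r
    assume "0 \<le> r" "a x = ennreal r" "b x = top"
    then show ?thesis
      by (simp add: p_def q_def e2ennreal_neg)
  next
    fix t
    assume "a x = top" "0 \<le> t" "b x = ennreal t"
    then show ?thesis
      by (simp add: p_def q_def e2ennreal_neg)
  qed (use that in simp)
  have ae: "AE x in P. a x < \<infinity> \<or> b x < \<infinity>"
    using fin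
  proof
    assume "(\<integral>\<^sup>+ x. a x \<partial>P) < \<infinity>"
    then have "AE x in P. a x \<noteq> \<infinity>"
      by (intro nn_integral_PInf_AE) auto
    then show ?thesis by eventually_elim (auto simp: less_top)
  next
    assume "(\<integral>\<^sup>+ x. b x \<partial>P) < \<infinity>"
    then have "AE x in P. b x \<noteq> \<infinity>"
      by (intro nn_integral_PInf_AE) auto
    then show ?thesis by eventually_elim (auto simp: less_top)
  qed
  have eq: "(\<integral>\<^sup>+ x. p x \<partial>P) + (\<integral>\<^sup>+ x. b x \<partial>P) = (\<integral>\<^sup>+ x. a x \<partial>P) + (\<integral>\<^sup>+ x. q x \<partial>P)"
    using ae pt by (subst (1 2) nn_integral_add[symmetric]) (auto intro!: nn_integral_cong_AE)
  have le: "(\<integral>\<^sup>+ x. p x \<partial>P) \<le> (\<integral>\<^sup>+ x. a x \<partial>P)" "(\<integral>\<^sup>+ x. q x \<partial>P) \<le> (\<integral>\<^sup>+ x. b x \<partial>P)"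
    using ae pt by (auto intro!: nn_integral_mono_AE)
  have "enn2ereal A - enn2ereal B = enn2ereal p' - enn2ereal q'"
    if "p' + B = A + q'" "p' \<le> A" "q' \<le> B" "A < \<infinity> \<or> B < \<infinity>" for A B p' q' :: ennreal
    using that
    by (cases A; cases B; cases p'; cases q')
      (auto simp: ennreal_plus[symmetric] top_unique simp del: ennreal_plus)
  from this[OF eq le fin] show ?thesis
    by (simp add: ext_integral_def p_def q_def)
qed

section \<open>Sign and logarithm of a law\<close>

text \<open>
  For \<open>s = 1\<close> and \<open>s = -1\<close> these are the two components of the image of \<open>Q\<close>, without its mass at
  \<open>0\<close>, under \<open>x \<mapsto> (sgn x, ln \<bar>x\<bar>)\<close>.
\<close>

definition signed_log :: "real measure \<Rightarrow> real \<Rightarrow> real measure" where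
  "signed_log Q s = distr (density Q (\<lambda>x. of_bool (sgn x = s))) borel (\<lambda>x. ln \<bar>x\<bar>)"

lemma sets_signed_log [simp, measurable_cong]: "sets (signed_log Q s) = sets borel"
  by (simp add: signed_log_def)

lemma space_signed_log [simp]: "space (signed_log Q s) = UNIV"
  by (simp add: signed_log_def)

lemma nn_integral_signed_log:
  assumes [measurable_cong]: "sets Q = sets borel" and [measurable]: "f \<in> borel_measurable borel"
  shows "(\<integral>\<^sup>+ t. f t \<partial>signed_log Q s) = (\<integral>\<^sup>+ x. of_bool (sgn x = s) * f (ln \<bar>x\<bar>) \<partial>Q)"
  unfolding signed_log_def
  by (subst nn_integral_distr, measurable, subst nn_integral_density, measurable)

lemma emeasure_signed_log:
  assumes "sets Q = sets borel" and "B \<in> sets borel"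
  shows "emeasure (signed_log Q s) B = (\<integral>\<^sup>+ x. of_bool (sgn x = s \<and> ln \<bar>x\<bar> \<in> B) \<partial>Q)"
proof -
  have "emeasure (signed_log Q s) B = (\<integral>\<^sup>+ t. indicator B t \<partial>signed_log Q s)"
    using assms by simp
  also have "\<dots> = (\<integral>\<^sup>+ x. of_bool (sgn x = s) * indicator B (ln \<bar>x\<bar>) \<partial>Q)"
    using assms by (subst nn_integral_signed_log) auto
  also have "\<dots> = (\<integral>\<^sup>+ x. of_bool (sgn x = s \<and> ln \<bar>x\<bar> \<in> B) \<partial>Q)"
    by (intro nn_integral_cong) (auto split: split_indicator)
  finally show ?thesis .
qed

lemma finite_measure_signed_log:
  assumes "finite_measure Q" and [simp]: "sets Q = sets borel"
  shows "finite_measure (signed_log Q s)"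
proof (rule finite_measureI)
  interpret finite_measure Q by fact
  have "emeasure (signed_log Q s) (space (signed_log Q s)) \<le> (\<integral>\<^sup>+ x. 1 \<partial>Q)"
    by (subst emeasure_signed_log) (auto simp del: nn_integral_const intro!: nn_integral_mono)
  also have "\<dots> < \<infinity>"
    by (simp add: less_top[symmetric])
  finally show "emeasure (signed_log Q s) (space (signed_log Q s)) \<noteq> \<infinity>" by simp
qed

text \<open>
  If \<open>R\<close> is the law of \<open>x y\<close> under \<open>P \<Otimes> Q\<close>, then \<open>x y\<close> has sign \<open>s\<close> exactly if \<open>(sgn x, sgn y)\<close>
  is \<open>(1, s)\<close> or \<open>(-1, -s)\<close>, and \<open>ln \<bar>x y\<bar> = ln \<bar>x\<bar> + ln \<bar>y\<bar>\<close> in both cases. The two cases give the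
  two terms of a row of the matrix product. The hypothesis on \<open>s\<close> excludes the factor \<open>0\<close>.
\<close>

lemma signed_log_mult:
  assumes fin: "finite_measure P" "finite_measure Q"
    and [simp, measurable_cong]: "sets P = sets borel" "sets Q = sets borel" "sets R = sets borel"
    and R: "\<And>f. f \<in> borel_measurable borel \<Longrightarrow>
      (\<integral>\<^sup>+ z. f z \<partial>R) = (\<integral>\<^sup>+ x. \<integral>\<^sup>+ y. f (x * y) \<partial>Q \<partial>P)"
    and s: "s = 1 \<or> s = -1"
    and B [measurable]: "B \<in> sets borel"
  shows "emeasure (signed_log R s) B =
    emeasure (signed_log P 1 \<star> signed_log Q s) B + emeasure (signed_log P (-1) \<star> signed_log Q (- s)) B"
proof -
  interpret Q: finite_measure Q by fact
  have conv: "emeasure (signed_log P u \<star> signed_log Q v) B =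
      (\<integral>\<^sup>+ x. \<integral>\<^sup>+ y. of_bool (sgn x = u) * (of_bool (sgn y = v) * indicator B (ln \<bar>x\<bar> + ln \<bar>y\<bar>)) \<partial>Q \<partial>P)" for u v
  proof -
    interpret Qv: finite_measure "signed_log Q v"
      using fin by (simp add: finite_measure_signed_log)
    have "emeasure (signed_log P u \<star> signed_log Q v) B =
        (\<integral>\<^sup>+ t. indicator B t \<partial>(signed_log P u \<star> signed_log Q v))"
      by simp
    also have "\<dots> = (\<integral>\<^sup>+ a. \<integral>\<^sup>+ b. indicator B (a + b) \<partial>signed_log Q v \<partial>signed_log P u)"
      using fin by (intro nn_integral_convolution) (auto simp: finite_measure_signed_log)
    also have "\<dots> = (\<integral>\<^sup>+ x. of_bool (sgn x = u) *
        (\<integral>\<^sup>+ b. indicator B (ln \<bar>x\<bar> + b) \<partial>signed_log Q v) \<partial>P)"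
      by (rule nn_integral_signed_log) measurable
    also have "\<dots> = (\<integral>\<^sup>+ x. of_bool (sgn x = u) *
        (\<integral>\<^sup>+ y. of_bool (sgn y = v) * indicator B (ln \<bar>x\<bar> + ln \<bar>y\<bar>) \<partial>Q) \<partial>P)"
      by (subst nn_integral_signed_log) auto
    also have "\<dots> = (\<integral>\<^sup>+ x. \<integral>\<^sup>+ y. of_bool (sgn x = u) *
        (of_bool (sgn y = v) * indicator B (ln \<bar>x\<bar> + ln \<bar>y\<bar>)) \<partial>Q \<partial>P)"
      by (subst nn_integral_cmult) auto
    finally show ?thesis .
  qed
  have pt: "of_bool (sgn (x * y) = s) * indicator B (ln \<bar>x * y\<bar>) =
      of_bool (sgn x = 1) * (of_bool (sgn y = s) * indicator B (ln \<bar>x\<bar> + ln \<bar>y\<bar>)) +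
      of_bool (sgn x = - 1) * (of_bool (sgn y = - s) * (indicator B (ln \<bar>x\<bar> + ln \<bar>y\<bar>) :: ennreal))" for x y :: real
    using s by (auto simp: sgn_if abs_mult ln_mult zero_less_mult_iff mult_less_0_iff)
  have "emeasure (signed_log R s) B = (\<integral>\<^sup>+ t. indicator B t \<partial>signed_log R s)"
    by simp
  also have "\<dots> = (\<integral>\<^sup>+ z. of_bool (sgn z = s) * indicator B (ln \<bar>z\<bar>) \<partial>R)"
    by (rule nn_integral_signed_log) auto
  also have "\<dots> = (\<integral>\<^sup>+ x. \<integral>\<^sup>+ y. of_bool (sgn (x * y) = s) * indicator B (ln \<bar>x * y\<bar>) \<partial>Q \<partial>P)"
    by (rule R) measurable
  also have "\<dots> = emeasure (signed_log P 1 \<star> signed_log Q s) B + emeasure (signed_log P (-1) \<star> signed_log Q (- s)) B"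
    unfolding pt conv
    by (subst nn_integral_add, measurable, subst nn_integral_add, measurable)
  finally show ?thesis .
qed

section \<open>The tree as an iid family of real sequences\<close>

text \<open>
  The random generation \<open>A\<^sub>n\<close> is replaced by the fixed countable set of all words of length \<open>n\<close>.
  The vectors are zero beyond their length, so the product along the path to a word that
  is not an individual vanishes, and terms of weight zero contribute to none of the sums.
\<close>

definition level :: "nat \<Rightarrow> nat list set" where
  "level n = {i \<in> nodes. length i = n}"

lemma level_0 [simp]: "level 0 = {[]}"
  by (auto simp: level_def nodes_def)

lemma Nil_in_nodes [simp]: "[] \<in> nodes"
  by (simp add: nodes_def)

lemma snoc_in_nodes [simp]: "i @ [j] \<in> nodes \<longleftrightarrow> i \<in> nodes \<and> 1 \<le> j"
  by (auto simp: nodes_def)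

lemma take_in_nodes: "i \<in> nodes \<Longrightarrow> take k i \<in> nodes"
  by (auto simp: nodes_def dest: in_set_takeD)

lemma countable_level [simp]: "countable (level n)"
  by (rule countable_subset[of _ UNIV]) auto

lemma bij_betw_level_Suc: "bij_betw (\<lambda>(i, j). i @ [j]) (level n \<times> {1..}) (level (Suc n))"
proof (rule bij_betwI')
  fix y assume y: "y \<in> level (Suc n)"
  then have "y = butlast y @ [last y]"
    by (auto simp: level_def intro!: append_butlast_last_id[symmetric])
  with y have "(butlast y, last y) \<in> level n \<times> {1..}"
    unfolding level_def by simp (metis One_nat_def snoc_in_nodes)
  with \<open>y = _\<close> show "\<exists>x\<in>level n \<times> {1..}. y = (case x of (i, j) \<Rightarrow> i @ [j])"
    by force
qed (auto simp: level_def)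

lemma nn_integral_level_Suc:
  "(\<integral>\<^sup>+ i. f i \<partial>count_space (level (Suc n))) =
    (\<integral>\<^sup>+ i. \<integral>\<^sup>+ j. f (i @ [j]) \<partial>count_space {1..} \<partial>count_space (level n))"
proof -
  interpret sigma_finite_measure "count_space {1::nat..}"
    by (intro sigma_finite_measure_count_space_countable) simp
  have "(\<integral>\<^sup>+ i. f i \<partial>count_space (level (Suc n))) =
      (\<integral>\<^sup>+ p. f (case p of (i, j) \<Rightarrow> i @ [j]) \<partial>count_space (level n \<times> {1..}))"
    by (rule nn_integral_bij_count_space[OF bij_betw_level_Suc, symmetric])
  also have "\<dots> = (\<integral>\<^sup>+ p. f (case p of (i, j) \<Rightarrow> i @ [j]) \<partial>(count_space (level n) \<Otimes>\<^sub>M count_space {1..}))"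
    by (simp add: pair_measure_countable)
  also have "\<dots> = (\<integral>\<^sup>+ i. \<integral>\<^sup>+ j. f (i @ [j]) \<partial>count_space {1..} \<partial>count_space (level n))"
    by (subst nn_integral_fst[symmetric]) (simp_all add: pair_measure_countable)
  finally show ?thesis .
qed

text \<open>
  A function of the family of all vectors, so that its dependence on the proper prefixes of
  \<open>i\<close> alone is visible; independence of \<open>tree_weight N C i\<close> and the vector at \<open>i\<close> rests on this.
\<close>

definition path_weight :: "(nat list \<Rightarrow> enat \<times> (nat \<Rightarrow> real)) \<Rightarrow> nat list \<Rightarrow> real" where
  "path_weight v i = (\<Prod>k<length i. snd (v (take k i)) (i ! k))"

lemma path_weight_Nil [simp]: "path_weight v [] = 1"
  by (simp add: path_weight_def)

lemma path_weight_snoc: "path_weight v (i @ [j]) = path_weight v i * snd (v i) j"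
  by (simp add: path_weight_def nth_append)

lemma path_weight_restrict:
  "path_weight (restrict v {take k i |k. k < length i}) i = path_weight v i"
  unfolding path_weight_def by (intro prod.cong refl) auto

lemma measurable_snd_vec [measurable]:
  "1 \<le> j \<Longrightarrow> (\<lambda>v. snd v j) \<in> borel_measurable vec_space"
  unfolding vec_space_def by measurable

lemma measurable_path_weight:
  assumes i: "i \<in> nodes" and K: "\<And>k. k < length i \<Longrightarrow> take k i \<in> K"
  shows "(\<lambda>v. path_weight v i) \<in> borel_measurable (Pi\<^sub>M K (\<lambda>_. vec_space))"
  unfolding path_weight_def
proof (rule borel_measurable_prod)
  fix k assume "k \<in> {..<length i}"
  then have k: "k < length i" by simp
  then have "1 \<le> i ! k" using i by (auto simp: nodes_def)
  then show "(\<lambda>v. snd (v (take k i)) (i ! k)) \<in> borel_measurable (Pi\<^sub>M K (\<lambda>_. vec_space))"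
    by (intro measurable_compose[OF measurable_component_singleton[OF K[OF k]] measurable_snd_vec])
qed

definition tree_weight ::
  "(nat list \<Rightarrow> 'a \<Rightarrow> enat) \<Rightarrow> (nat list \<Rightarrow> 'a \<Rightarrow> real) \<Rightarrow> nat list \<Rightarrow> 'a \<Rightarrow> real" where
  "tree_weight N C i \<omega> = path_weight (\<lambda>u. node_vec N C u \<omega>) i"

lemma tree_weight_Nil [simp]: "tree_weight N C [] \<omega> = 1"
  by (simp add: tree_weight_def)

lemma tree_weight_snoc:
  "tree_weight N C (i @ [j]) \<omega> = tree_weight N C i \<omega> * snd (node_vec N C i \<omega>) j"
  by (simp add: tree_weight_def path_weight_snoc)

lemma snd_node_vec:
  "1 \<le> j \<Longrightarrow> snd (node_vec N C i \<omega>) j = (if j \<in> offspring (N i \<omega>) then C (i @ [j]) \<omega> else 0)"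
  by (simp add: node_vec_def)

lemma generation_subset_level: "generation N n \<omega> \<subseteq> level n"
  by (induction n) (fastforce simp: level_def offspring_def)+

text \<open>
  Along the path to a word outside the generation some ancestor has too few children, and the
  corresponding factor is zero.
\<close>

lemma tree_weight_eq:
  "i \<in> level n \<Longrightarrow> tree_weight N C i \<omega> = (if i \<in> generation N n \<omega> then weight C i \<omega> else 0)"
proof (induction n arbitrary: i)
  case 0
  then show ?case by (simp add: weight_Nil)
next
  case (Suc n)
  from Suc.prems obtain u j where i: "i = u @ [j]" and u: "u \<in> level n" and j: "1 \<le> j"
    unfolding bij_betw_imp_surj_on[OF bij_betw_level_Suc[of n], symmetric] by auto
  show ?case
    using Suc.IH[OF u] j by (auto simp: i tree_weight_snoc snd_node_vec weight_snoc)
qed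

text \<open>
  The condition \<open>g 0 = 0\<close> removes the words outside the random generation.
\<close>

lemma nn_integral_generation:
  assumes "g 0 = 0"
  shows "(\<integral>\<^sup>+ i. g (weight C i \<omega>) \<partial>count_space (generation N n \<omega>)) =
    (\<integral>\<^sup>+ i. g (tree_weight N C i \<omega>) \<partial>count_space (level n))"
proof -
  have "(\<integral>\<^sup>+ i. g (weight C i \<omega>) \<partial>count_space (generation N n \<omega>)) =
      (\<integral>\<^sup>+ i. g (tree_weight N C i \<omega>) \<partial>count_space (generation N n \<omega>))"
    using generation_subset_level[of N n \<omega>]
    by (intro nn_integral_cong) (auto simp: tree_weight_eq)
  also have "\<dots> = (\<integral>\<^sup>+ i. g (tree_weight N C i \<omega>) \<partial>count_space (level n))"
    using generation_subset_level[of N n \<omega>]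
    by (intro nn_integral_count_space_eq) (auto simp: tree_weight_eq assms)
  finally show ?thesis .
qed

lemma nn_integral_offspring:
  assumes "g 0 = 0"
  shows "(\<integral>\<^sup>+ j. g (C [j] \<omega>) \<partial>count_space (offspring (N [] \<omega>))) =
    (\<integral>\<^sup>+ i. g (tree_weight N C i \<omega>) \<partial>count_space (level 1))"
proof -
  have "(\<integral>\<^sup>+ i. g (tree_weight N C i \<omega>) \<partial>count_space (level 1)) =
      (\<integral>\<^sup>+ j. g (snd (node_vec N C [] \<omega>) j) \<partial>count_space {1..})"
    by (simp add: nn_integral_level_Suc nn_integral_count_space_finite tree_weight_snoc[of N C "[]", simplified])
  also have "\<dots> = (\<integral>\<^sup>+ j. g (snd (node_vec N C [] \<omega>) j) \<partial>count_space (offspring (N [] \<omega>)))"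
    by (intro nn_integral_count_space_eq) (auto simp: snd_node_vec assms offspring_def)
  also have "\<dots> = (\<integral>\<^sup>+ j. g (C [j] \<omega>) \<partial>count_space (offspring (N [] \<omega>)))"
    by (intro nn_integral_cong) (auto simp: snd_node_vec offspring_def)
  finally show ?thesis ..
qed

context weighted_branching_tree
begin

lemma measurable_node_vec [measurable]:
  "i \<in> nodes \<Longrightarrow> node_vec N C i \<in> measurable M vec_space"
  using indep by (auto simp: indep_vars_def)

lemma measurable_tree_weight [measurable]:
  assumes "i \<in> nodes"
  shows "tree_weight N C i \<in> borel_measurable M"
proof -
  have "(\<lambda>\<omega>. \<lambda>u\<in>nodes. node_vec N C u \<omega>) \<in> measurable M (Pi\<^sub>M nodes (\<lambda>_. vec_space))"
    by (rule measurable_restrict) simp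
  from measurable_compose[OF this measurable_path_weight[OF assms]]
  have "(\<lambda>\<omega>. path_weight (\<lambda>u\<in>nodes. node_vec N C u \<omega>) i) \<in> borel_measurable M"
    using assms by (simp add: take_in_nodes)
  also have "(\<lambda>\<omega>. path_weight (\<lambda>u\<in>nodes. node_vec N C u \<omega>) i) = tree_weight N C i"
    using assms by (auto simp: tree_weight_def path_weight_def fun_eq_iff take_in_nodes)
  finally show ?thesis .
qed

lemma distr_snd_node_vec:
  assumes i: "i \<in> nodes" and j: "1 \<le> j"
  shows "distr M borel (\<lambda>\<omega>. snd (node_vec N C i \<omega>) j) = distr M borel (\<lambda>\<omega>. snd (node_vec N C [] \<omega>) j)"
proof -
  have "distr M borel (\<lambda>\<omega>. snd (node_vec N C u \<omega>) j) =
      distr (distr M vec_space (node_vec N C u)) borel (\<lambda>v. snd v j)" if "u \<in> nodes" for u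
    using that j by (simp add: distr_distr comp_def)
  with i show ?thesis by (simp add: ident[OF i])
qed

text \<open>
  The left variable is a function of the vectors at the proper prefixes of \<open>i\<close>, the right one of
  the vector at \<open>i\<close>.
\<close>

lemma indep_tree_weight:
  assumes i: "i \<in> nodes" and j: "1 \<le> j"
  shows "indep_var borel (tree_weight N C i) borel (\<lambda>\<omega>. snd (node_vec N C i \<omega>) j)"
proof -
  let ?K = "{take k i |k. k < length i}"
  have notin: "i \<notin> ?K"
  proof
    assume "i \<in> ?K"
    then obtain k where "i = take k i" "k < length i" by blast
    then show False by (metis length_take min.strict_order_iff min.commute nat_less_le)
  qed
  have "indep_var (Pi\<^sub>M ?K (\<lambda>_. vec_space)) (\<lambda>\<omega>. \<lambda>u\<in>?K. node_vec N C u \<omega>)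
      (Pi\<^sub>M {i} (\<lambda>_. vec_space)) (\<lambda>\<omega>. \<lambda>u\<in>{i}. node_vec N C u \<omega>)"
    using i notin by (intro indep_var_restrict[OF indep]) (auto simp: take_in_nodes)
  moreover have "(\<lambda>v. path_weight v i) \<in> borel_measurable (Pi\<^sub>M ?K (\<lambda>_. vec_space))"
    using i by (intro measurable_path_weight) auto
  moreover have "(\<lambda>v. snd (v i) j) \<in> borel_measurable (Pi\<^sub>M {i} (\<lambda>_. vec_space))"
    using measurable_compose[OF measurable_component_singleton[of i "{i}" "\<lambda>_. vec_space"]
        measurable_snd_vec[OF j]] by simp
  ultimately have "indep_var borel ((\<lambda>v. path_weight v i) \<circ> (\<lambda>\<omega>. \<lambda>u\<in>?K. node_vec N C u \<omega>))
      borel ((\<lambda>v. snd (v i) j) \<circ> (\<lambda>\<omega>. \<lambda>u\<in>{i}. node_vec N C u \<omega>))"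
    by (rule indep_var_compose)
  then show ?thesis
    by (simp add: comp_def path_weight_restrict tree_weight_def[abs_def])
qed

text \<open>
  The branching property: by independence and equality of laws, the vector at \<open>i\<close> may be
  replaced by the root vector on a second copy \<open>\<omega>'\<close> of the probability space.
\<close>

lemma nn_integral_branch:
  assumes i: "i \<in> nodes" and j: "1 \<le> j"
    and f [measurable]: "case_prod f \<in> borel_measurable (borel \<Otimes>\<^sub>M borel)"
  shows "(\<integral>\<^sup>+ \<omega>. f (tree_weight N C i \<omega>) (snd (node_vec N C i \<omega>) j) \<partial>M) =
    (\<integral>\<^sup>+ \<omega>. \<integral>\<^sup>+ \<omega>'. f (tree_weight N C i \<omega>) (snd (node_vec N C [] \<omega>') j) \<partial>M \<partial>M)"
proof -
  let ?X = "tree_weight N C i" and ?Y = "\<lambda>i \<omega>. snd (node_vec N C i \<omega>) j"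
  note [measurable] = i
  have mY [measurable]: "?Y u \<in> borel_measurable M" if "u \<in> nodes" for u
    using j that by measurable
  interpret Y: prob_space "distr M borel (?Y [])"
    by (rule prob_space_distr) (rule mY, simp)
  have "(\<integral>\<^sup>+ \<omega>. f (?X \<omega>) (?Y i \<omega>) \<partial>M) =
      (\<integral>\<^sup>+ p. case_prod f p \<partial>distr M (borel \<Otimes>\<^sub>M borel) (\<lambda>\<omega>. (?X \<omega>, ?Y i \<omega>)))"
    using i by (subst nn_integral_distr) auto
  also have "\<dots> = (\<integral>\<^sup>+ p. case_prod f p \<partial>(distr M borel ?X \<Otimes>\<^sub>M distr M borel (?Y [])))"
    using indep_tree_weight[OF i j] distr_snd_node_vec[OF i j]
    by (simp add: indep_var_distribution_eq)
  also have "\<dots> = (\<integral>\<^sup>+ x. \<integral>\<^sup>+ y. f x y \<partial>distr M borel (?Y []) \<partial>distr M borel ?X)"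
    using f by (subst Y.nn_integral_fst[symmetric])
      (simp_all add: measurable_cong_sets[OF sets_pair_measure_cong[OF sets_distr sets_distr] refl])
  also have "\<dots> = (\<integral>\<^sup>+ \<omega>. \<integral>\<^sup>+ y. f (?X \<omega>) y \<partial>distr M borel (?Y []) \<partial>M)"
    using i by (subst nn_integral_distr) auto
  also have "\<dots> = (\<integral>\<^sup>+ \<omega>. \<integral>\<^sup>+ \<omega>'. f (?X \<omega>) (?Y [] \<omega>') \<partial>M \<partial>M)"
    using mY[of "[]"] by (subst nn_integral_distr) auto
  finally show ?thesis .
qed

end

section \<open>The tilted weight laws\<close>

text \<open>
  The law of the weight under counting measure on the words of length \<open>n\<close> times \<open>P\<close>,
  weighted by \<open>\<bar>\<Pi>\<^sub>i\<bar>\<^sup>\<alpha>\<close>. Any mass at \<open>0\<close> disappears: there the weighting factor is \<open>0 powr \<alpha> = 0\<close>.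
\<close>

definition tilted_law ::
  "'a measure \<Rightarrow> (nat list \<Rightarrow> 'a \<Rightarrow> enat) \<Rightarrow> (nat list \<Rightarrow> 'a \<Rightarrow> real) \<Rightarrow> real \<Rightarrow> nat \<Rightarrow> real measure" where
  "tilted_law M N C \<alpha> n =
    distr (density (count_space (level n) \<Otimes>\<^sub>M M) (\<lambda>(i, \<omega>). ennreal (\<bar>tree_weight N C i \<omega>\<bar> powr \<alpha>)))
      borel (\<lambda>(i, \<omega>). tree_weight N C i \<omega>)"

lemma sets_tilted_law [simp, measurable_cong]: "sets (tilted_law M N C \<alpha> n) = sets borel"
  by (simp add: tilted_law_def)

lemma space_tilted_law [simp]: "space (tilted_law M N C \<alpha> n) = UNIV"
  by (simp add: tilted_law_def)

context weighted_branching_tree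
begin

lemma measurable_tree_weight_pair [measurable]:
  "(\<lambda>(i, \<omega>). tree_weight N C i \<omega>) \<in> borel_measurable (count_space (level n) \<Otimes>\<^sub>M M)"
  by (rule measurable_pair_measure_countable1) (auto simp: level_def)

lemma nn_integral_tilted_law:
  assumes [measurable]: "f \<in> borel_measurable borel"
  shows "(\<integral>\<^sup>+ x. f x \<partial>tilted_law M N C \<alpha> n) =
    (\<integral>\<^sup>+ i. \<integral>\<^sup>+ \<omega>. ennreal (\<bar>tree_weight N C i \<omega>\<bar> powr \<alpha>) * f (tree_weight N C i \<omega>) \<partial>M \<partial>count_space (level n))"
proof -
  have "(\<integral>\<^sup>+ x. f x \<partial>tilted_law M N C \<alpha> n) =
     (\<integral>\<^sup>+ p. (case p of (i, \<omega>) \<Rightarrow> ennreal (\<bar>tree_weight N C i \<omega>\<bar> powr \<alpha>)) * f (case p of (i, \<omega>) \<Rightarrow> tree_weight N C i \<omega>)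
       \<partial>(count_space (level n) \<Otimes>\<^sub>M M))"
    unfolding tilted_law_def
    by (subst nn_integral_distr, measurable, subst nn_integral_density, measurable)
  then show ?thesis
    by (subst (asm) nn_integral_fst[symmetric]) auto
qed

lemma nn_integral_tilted_law_swap:
  assumes [measurable]: "f \<in> borel_measurable borel"
  shows "(\<integral>\<^sup>+ x. f x \<partial>tilted_law M N C \<alpha> n) =
    (\<integral>\<^sup>+ \<omega>. \<integral>\<^sup>+ i. ennreal (\<bar>tree_weight N C i \<omega>\<bar> powr \<alpha>) * f (tree_weight N C i \<omega>) \<partial>count_space (level n) \<partial>M)"
  unfolding nn_integral_tilted_law[OF assms]
  by (rule nn_integral_count_space_nn_integral[symmetric]) (auto simp: level_def)

lemma tilted_law_0: "tilted_law M N C \<alpha> 0 = return borel 1"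
proof (rule measure_eqI)
  fix B assume "B \<in> sets (tilted_law M N C \<alpha> 0)"
  then have B [measurable]: "B \<in> sets borel" by simp
  have "emeasure (tilted_law M N C \<alpha> 0) B = (\<integral>\<^sup>+ x. indicator B x \<partial>tilted_law M N C \<alpha> 0)"
    by simp
  also have "\<dots> = emeasure (return borel 1) B"
    by (subst nn_integral_tilted_law) (auto simp: nn_integral_count_space_finite emeasure_space_1)
  finally show "emeasure (tilted_law M N C \<alpha> 0) B = emeasure (return borel 1) B" .
qed simp

lemma nn_integral_tilted_law_1:
  assumes [measurable]: "f \<in> borel_measurable borel"
  shows "(\<integral>\<^sup>+ x. f x \<partial>tilted_law M N C \<alpha> 1) =
    (\<integral>\<^sup>+ j. \<integral>\<^sup>+ \<omega>. ennreal (\<bar>snd (node_vec N C [] \<omega>) j\<bar> powr \<alpha>) * f (snd (node_vec N C [] \<omega>) j) \<partial>M \<partial>count_space {1..})"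
  by (simp add: nn_integral_tilted_law nn_integral_level_Suc nn_integral_count_space_finite
      tree_weight_snoc[of N C "[]", simplified])

text \<open>
  A word of length \<open>n + 1\<close> is a word of length \<open>n\<close> and a last letter. The branching property makes
  the last factor of the weight independent of the others, and \<open>\<bar>x y\<bar>\<^sup>\<alpha> = \<bar>x\<bar>\<^sup>\<alpha> \<bar>y\<bar>\<^sup>\<alpha>\<close> splits
  the tilting factor. Sigma-finiteness of the first law serves to make the inner integral
  measurable in \<open>x\<close>.
\<close>

lemma nn_integral_tilted_law_Suc:
  assumes [measurable]: "f \<in> borel_measurable borel"
    and "sigma_finite_measure (tilted_law M N C \<alpha> 1)"
  shows "(\<integral>\<^sup>+ z. f z \<partial>tilted_law M N C \<alpha> (Suc n)) =
    (\<integral>\<^sup>+ x. \<integral>\<^sup>+ y. f (x * y) \<partial>tilted_law M N C \<alpha> 1 \<partial>tilted_law M N C \<alpha> n)"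
proof -
  interpret Q: sigma_finite_measure "tilted_law M N C \<alpha> 1" by fact
  let ?W = "tree_weight N C" and ?Y = "\<lambda>i \<omega> j. snd (node_vec N C i \<omega>) j"
  let ?e = "\<lambda>x::real. ennreal (\<bar>x\<bar> powr \<alpha>)"
  have mY [measurable]: "(\<lambda>\<omega>. ?Y [] \<omega> j) \<in> borel_measurable M" if "1 \<le> j" for j
    using that by measurable
  have inner: "(\<integral>\<^sup>+ y. f (x * y) \<partial>tilted_law M N C \<alpha> 1) =
      (\<integral>\<^sup>+ j. \<integral>\<^sup>+ \<omega>. ?e (?Y [] \<omega> j) * f (x * ?Y [] \<omega> j) \<partial>M \<partial>count_space {1..})" for x
    by (rule nn_integral_tilted_law_1) measurable
  have "(\<integral>\<^sup>+ z. f z \<partial>tilted_law M N C \<alpha> (Suc n)) =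
      (\<integral>\<^sup>+ i. \<integral>\<^sup>+ j. \<integral>\<^sup>+ \<omega>. ?e (?W i \<omega> * ?Y i \<omega> j) * f (?W i \<omega> * ?Y i \<omega> j) \<partial>M
        \<partial>count_space {1..} \<partial>count_space (level n))"
    by (simp add: nn_integral_tilted_law nn_integral_level_Suc tree_weight_snoc)
  also have "\<dots> = (\<integral>\<^sup>+ i. \<integral>\<^sup>+ \<omega>. ?e (?W i \<omega>) *
      (\<integral>\<^sup>+ j. \<integral>\<^sup>+ \<omega>'. ?e (?Y [] \<omega>' j) * f (?W i \<omega> * ?Y [] \<omega>' j) \<partial>M \<partial>count_space {1..}) \<partial>M
        \<partial>count_space (level n))"
  proof (intro nn_integral_cong, simp)
    fix i assume "i \<in> level n"
    then have i [measurable]: "i \<in> nodes" by (simp add: level_def)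
    have "(\<integral>\<^sup>+ j. \<integral>\<^sup>+ \<omega>. ?e (?W i \<omega> * ?Y i \<omega> j) * f (?W i \<omega> * ?Y i \<omega> j) \<partial>M \<partial>count_space {1..}) =
      (\<integral>\<^sup>+ j. \<integral>\<^sup>+ \<omega>. \<integral>\<^sup>+ \<omega>'. ?e (?W i \<omega> * ?Y [] \<omega>' j) * f (?W i \<omega> * ?Y [] \<omega>' j) \<partial>M \<partial>M \<partial>count_space {1..})"
      using i by (intro nn_integral_cong nn_integral_branch[where f="\<lambda>x y. ?e (x * y) * f (x * y)"]) auto
    also have "\<dots> = (\<integral>\<^sup>+ j. \<integral>\<^sup>+ \<omega>. ?e (?W i \<omega>) *
        (\<integral>\<^sup>+ \<omega>'. ?e (?Y [] \<omega>' j) * f (?W i \<omega> * ?Y [] \<omega>' j) \<partial>M) \<partial>M \<partial>count_space {1..})"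
      by (intro nn_integral_cong, subst nn_integral_cmult[symmetric])
         (auto simp: abs_mult powr_mult ennreal_mult mult.assoc)
    also have "\<dots> = (\<integral>\<^sup>+ \<omega>. \<integral>\<^sup>+ j. ?e (?W i \<omega>) *
        (\<integral>\<^sup>+ \<omega>'. ?e (?Y [] \<omega>' j) * f (?W i \<omega> * ?Y [] \<omega>' j) \<partial>M) \<partial>count_space {1..} \<partial>M)"
      using i by (intro nn_integral_count_space_nn_integral[symmetric]) auto
    also have "\<dots> = (\<integral>\<^sup>+ \<omega>. ?e (?W i \<omega>) *
      (\<integral>\<^sup>+ j. \<integral>\<^sup>+ \<omega>'. ?e (?Y [] \<omega>' j) * f (?W i \<omega> * ?Y [] \<omega>' j) \<partial>M \<partial>count_space {1..}) \<partial>M)"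
      by (intro nn_integral_cong nn_integral_cmult) simp
    finally show "(\<integral>\<^sup>+ j. \<integral>\<^sup>+ \<omega>. ?e (?W i \<omega> * ?Y i \<omega> j) * f (?W i \<omega> * ?Y i \<omega> j) \<partial>M \<partial>count_space {Suc 0..}) =
      (\<integral>\<^sup>+ \<omega>. ?e (?W i \<omega>) *
      (\<integral>\<^sup>+ j. \<integral>\<^sup>+ \<omega>'. ?e (?Y [] \<omega>' j) * f (?W i \<omega> * ?Y [] \<omega>' j) \<partial>M \<partial>count_space {Suc 0..}) \<partial>M)"
      by simp
  qed
  also have "\<dots> = (\<integral>\<^sup>+ x. \<integral>\<^sup>+ y. f (x * y) \<partial>tilted_law M N C \<alpha> 1 \<partial>tilted_law M N C \<alpha> n)"
    unfolding inner[symmetric] by (rule nn_integral_tilted_law[symmetric]) measurable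
  finally show ?thesis .
qed

lemma prob_space_tilted_law:
  assumes "prob_space (tilted_law M N C \<alpha> 1)"
  shows "prob_space (tilted_law M N C \<alpha> n)"
proof (induction n)
  case 0
  show ?case by (simp add: tilted_law_0 prob_space_return)
next
  case (Suc n)
  interpret P: prob_space "tilted_law M N C \<alpha> n" by (rule Suc)
  interpret Q: prob_space "tilted_law M N C \<alpha> 1" by (rule assms)
  have "(\<integral>\<^sup>+ z. 1 \<partial>tilted_law M N C \<alpha> (Suc n)) = 1"
    by (subst nn_integral_tilted_law_Suc)
      (use Q.sigma_finite_measure_axioms P.emeasure_space_1 Q.emeasure_space_1 in auto)
  then show ?case by (intro prob_spaceI) simp
qed

end

section \<open>Identification of the measures of the tree\<close>

definition ext_log :: "real \<Rightarrow> ereal" where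
  "ext_log x = (if x = 0 then -\<infinity> else ereal (ln \<bar>x\<bar>))"

lemma log_weight_eq: "log_weight C i \<omega> = ext_log (weight C i \<omega>)"
  by (simp add: log_weight_def ext_log_def)

lemma measurable_ext_log [measurable]: "ext_log \<in> borel_measurable borel"
  unfolding ext_log_def by measurable

lemma measurable_exp_factor [measurable]: "exp_factor \<alpha> \<in> borel_measurable borel"
  unfolding exp_factor_def by measurable

lemma range_ereal_in_borel [measurable]: "range ereal \<in> sets borel"
proof -
  have "range ereal = UNIV - {\<infinity>, -\<infinity>}"
  proof (intro equalityI subsetI)
    fix x :: ereal assume "x \<in> UNIV - {\<infinity>, -\<infinity>}"
    then show "x \<in> range ereal" by (cases x) auto
  qed auto
  then show ?thesis by simp
qed

lemma sets_mu_ext [simp, measurable_cong]: "sets (mu_ext M N C \<alpha> s n) = sets borel"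
  by (simp add: mu_ext_def intensity_def)

text \<open>
  The factor \<open>e\<^sup>\<alpha>\<^sup>t\<close> vanishes at \<open>t = -\<infinity>\<close>.
\<close>

lemma emeasure_mu_ext_minf: "emeasure (mu_ext M N C \<alpha> s n) {-\<infinity>} = 0"
proof -
  have [simp, measurable_cong]: "sets (intensity M N C s n) = sets borel"
    using sets_mu_ext[of M N C \<alpha> s n] by (simp add: mu_ext_def)
  have "emeasure (mu_ext M N C \<alpha> s n) {-\<infinity>} =
      (\<integral>\<^sup>+ t. exp_factor \<alpha> t * indicator {-\<infinity>} t \<partial>intensity M N C s n)"
    unfolding mu_ext_def by (rule emeasure_density) simp_all
  also have "\<dots> = (\<integral>\<^sup>+ t. 0 \<partial>intensity M N C s n)"
    by (intro nn_integral_cong) (auto simp: exp_factor_def split: split_indicator)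
  finally show ?thesis by simp
qed

context weighted_branching_tree
begin

text \<open>
  The defining formula of \<open>intensity\<close> is here an image measure on words times outcomes, so that
  integrals against it follow from the rules for densities and images.
\<close>

lemma intensity_eq:
  assumes "s \<noteq> 0"
  shows "intensity M N C s n =
    distr (density (count_space (level n) \<Otimes>\<^sub>M M) (\<lambda>(i, \<omega>). of_bool (sgn (tree_weight N C i \<omega>) = s)))
      borel (\<lambda>(i, \<omega>). ext_log (tree_weight N C i \<omega>))" (is "_ = ?D")
  unfolding intensity_def
proof (rule measure_of_borel_eqI)
  fix B :: "ereal set" assume B [measurable]: "B \<in> sets borel"
  define g :: "real \<Rightarrow> ennreal" where "g x = of_bool (sgn x = s \<and> ext_log x \<in> B)" for x
  have g0: "g 0 = 0"
    using assms by (simp add: g_def)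
  have [measurable]: "g \<in> borel_measurable borel"
    unfolding g_def by measurable
  have "(\<integral>\<^sup>+ \<omega>. \<integral>\<^sup>+ i. of_bool (sgn (weight C i \<omega>) = s \<and> log_weight C i \<omega> \<in> B)
      \<partial>count_space (generation N n \<omega>) \<partial>M) =
      (\<integral>\<^sup>+ \<omega>. \<integral>\<^sup>+ i. g (tree_weight N C i \<omega>) \<partial>count_space (level n) \<partial>M)"
    unfolding nn_integral_generation[of g, OF g0, symmetric] by (simp add: g_def log_weight_eq)
  also have "\<dots> = (\<integral>\<^sup>+ i. \<integral>\<^sup>+ \<omega>. g (tree_weight N C i \<omega>) \<partial>M \<partial>count_space (level n))"
    by (rule nn_integral_count_space_nn_integral) (auto simp: level_def)
  also have "\<dots> = (\<integral>\<^sup>+ p. g (case p of (i, \<omega>) \<Rightarrow> tree_weight N C i \<omega>) \<partial>(count_space (level n) \<Otimes>\<^sub>M M))"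
    by (subst nn_integral_fst[symmetric]) auto
  also have "\<dots> = (\<integral>\<^sup>+ p. (case p of (i, \<omega>) \<Rightarrow> of_bool (sgn (tree_weight N C i \<omega>) = s)) *
      indicator B (case p of (i, \<omega>) \<Rightarrow> ext_log (tree_weight N C i \<omega>)) \<partial>(count_space (level n) \<Otimes>\<^sub>M M))"
    by (intro nn_integral_cong) (auto simp: g_def split: split_indicator)
  also have "\<dots> = (\<integral>\<^sup>+ t. indicator B t \<partial>?D)"
    by (subst nn_integral_distr, measurable, subst nn_integral_density, measurable)
  also have "\<dots> = emeasure ?D B"
    by simp
  finally show "(\<integral>\<^sup>+ \<omega>. \<integral>\<^sup>+ i. of_bool (sgn (weight C i \<omega>) = s \<and> log_weight C i \<omega> \<in> B)
      \<partial>count_space (generation N n \<omega>) \<partial>M) = emeasure ?D B" .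
qed simp

text \<open>
  The density \<open>e\<^sup>\<alpha>\<^sup>t\<close> on the logarithmic scale is the density \<open>\<bar>x\<bar>\<^sup>\<alpha>\<close> on the original one.
\<close>

lemma mu_eq_signed_log:
  assumes "s \<noteq> 0"
  shows "mu M N C \<alpha> s n = signed_log (tilted_law M N C \<alpha> n) s"
proof (rule measure_eqI)
  fix B assume "B \<in> sets (mu M N C \<alpha> s n)"
  then have B [measurable]: "B \<in> sets borel" by (simp add: mu_def)
  let ?P = "count_space (level n) \<Otimes>\<^sub>M M" and ?W = "\<lambda>(i, \<omega>). tree_weight N C i \<omega>"
  let ?S = "real_of_ereal -` B \<inter> range ereal"
  have S [measurable]: "?S \<in> sets borel"
  proof -
    have "real_of_ereal -` B \<inter> space borel \<in> sets borel" by measurable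
    then show ?thesis by (auto intro: sets.Int)
  qed
  have "emeasure (mu M N C \<alpha> s n) B = emeasure (restrict_space (mu_ext M N C \<alpha> s n) (range ereal)) ?S"
  proof -
    have "real_of_ereal \<in> borel_measurable (mu_ext M N C \<alpha> s n)"
      by measurable
    then show ?thesis
      unfolding mu_def
      by (subst emeasure_distr)
         (simp_all add: measurable_restrict_space1 space_restrict_space sets_eq_imp_space_eq[OF sets_mu_ext])
  qed
  also have "\<dots> = emeasure (mu_ext M N C \<alpha> s n) ?S"
    by (rule emeasure_restrict_space) (auto simp: sets_eq_imp_space_eq[OF sets_mu_ext])
  also have "\<dots> = (\<integral>\<^sup>+ t. exp_factor \<alpha> t * indicator ?S t \<partial>intensity M N C s n)"
    unfolding mu_ext_def intensity_eq[OF assms] by (rule emeasure_density) auto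
  also have "\<dots> = (\<integral>\<^sup>+ p. (case p of (i, \<omega>) \<Rightarrow> of_bool (sgn (tree_weight N C i \<omega>) = s)) *
      (exp_factor \<alpha> (case p of (i, \<omega>) \<Rightarrow> ext_log (tree_weight N C i \<omega>)) *
       indicator ?S (case p of (i, \<omega>) \<Rightarrow> ext_log (tree_weight N C i \<omega>))) \<partial>?P)"
    unfolding intensity_eq[OF assms]
    by (subst nn_integral_distr, measurable, subst nn_integral_density, measurable)
  also have "\<dots> = (\<integral>\<^sup>+ p. ennreal (\<bar>?W p\<bar> powr \<alpha>) * of_bool (sgn (?W p) = s \<and> ln \<bar>?W p\<bar> \<in> B) \<partial>?P)"
    using assms
    by (intro nn_integral_cong)
       (auto simp: exp_factor_def ext_log_def powr_def mult.commute sgn_zero_iff split: split_indicator)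
  also have "\<dots> = (\<integral>\<^sup>+ i. \<integral>\<^sup>+ \<omega>. ennreal (\<bar>tree_weight N C i \<omega>\<bar> powr \<alpha>) *
      of_bool (sgn (tree_weight N C i \<omega>) = s \<and> ln \<bar>tree_weight N C i \<omega>\<bar> \<in> B) \<partial>M \<partial>count_space (level n))"
    by (subst nn_integral_fst[symmetric]) auto
  also have "\<dots> = (\<integral>\<^sup>+ x. of_bool (sgn x = s \<and> ln \<bar>x\<bar> \<in> B) \<partial>tilted_law M N C \<alpha> n)"
    by (rule nn_integral_tilted_law[symmetric]) measurable
  also have "\<dots> = emeasure (signed_log (tilted_law M N C \<alpha> n) s) B"
    by (rule emeasure_signed_log[symmetric]) simp_all
  finally show "emeasure (mu M N C \<alpha> s n) B = emeasure (signed_log (tilted_law M N C \<alpha> n) s) B" .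
qed (simp add: mu_def)

lemma nn_integral_tilted_law_offspring:
  assumes "f \<in> borel_measurable borel"
  shows "(\<integral>\<^sup>+ x. f x \<partial>tilted_law M N C \<alpha> 1) =
    (\<integral>\<^sup>+ \<omega>. \<integral>\<^sup>+ j. ennreal (\<bar>C [j] \<omega>\<bar> powr \<alpha>) * f (C [j] \<omega>) \<partial>count_space (offspring (N [] \<omega>)) \<partial>M)"
proof -
  let ?g = "\<lambda>x. ennreal (\<bar>x\<bar> powr \<alpha>) * f x"
  have "?g 0 = 0" by simp
  from nn_integral_offspring[where g = ?g and N = N and C = C, OF this] show ?thesis
    unfolding nn_integral_tilted_law_swap[OF assms] by (simp only:)
qed

text \<open>
  With \<open>f = 1\<close> and with \<open>f\<close> the positive or negative part of the identity, this gives the total mass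
  and the two parts of the mean of \<open>\<eta>\<^sub>+ + \<eta>\<^sub>-\<close>.
\<close>

lemma nn_integral_mu_1:
  assumes [measurable]: "f \<in> borel_measurable borel"
  shows "(\<integral>\<^sup>+ t. f t \<partial>mu M N C \<alpha> 1 1) + (\<integral>\<^sup>+ t. f t \<partial>mu M N C \<alpha> (-1) 1) =
    (\<integral>\<^sup>+ \<omega>. \<integral>\<^sup>+ j. ennreal (\<bar>C [j] \<omega>\<bar> powr \<alpha>) * f (ln \<bar>C [j] \<omega>\<bar>) \<partial>count_space (offspring (N [] \<omega>)) \<partial>M)"
proof -
  let ?Q = "tilted_law M N C \<alpha> 1"
  have "(\<integral>\<^sup>+ t. f t \<partial>mu M N C \<alpha> 1 1) + (\<integral>\<^sup>+ t. f t \<partial>mu M N C \<alpha> (-1) 1) =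
      (\<integral>\<^sup>+ x. of_bool (sgn x = 1) * f (ln \<bar>x\<bar>) \<partial>?Q) + (\<integral>\<^sup>+ x. of_bool (sgn x = - 1) * f (ln \<bar>x\<bar>) \<partial>?Q)"
    by (simp add: mu_eq_signed_log nn_integral_signed_log del: One_nat_def)
  also have "\<dots> = (\<integral>\<^sup>+ x. of_bool (sgn x = 1) * f (ln \<bar>x\<bar>) + of_bool (sgn x = - 1) * f (ln \<bar>x\<bar>) \<partial>?Q)"
    by (rule nn_integral_add[symmetric]) measurable
  also have "\<dots> = (\<integral>\<^sup>+ x. of_bool (x \<noteq> 0) * f (ln \<bar>x\<bar>) \<partial>?Q)"
    by (intro nn_integral_cong) (auto simp: sgn_if)
  also have "\<dots> = (\<integral>\<^sup>+ \<omega>. \<integral>\<^sup>+ j. ennreal (\<bar>C [j] \<omega>\<bar> powr \<alpha>) * (of_bool (C [j] \<omega> \<noteq> 0) * f (ln \<bar>C [j] \<omega>\<bar>))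
      \<partial>count_space (offspring (N [] \<omega>)) \<partial>M)"
    by (rule nn_integral_tilted_law_offspring) measurable
  also have "\<dots> = (\<integral>\<^sup>+ \<omega>. \<integral>\<^sup>+ j. ennreal (\<bar>C [j] \<omega>\<bar> powr \<alpha>) * f (ln \<bar>C [j] \<omega>\<bar>) \<partial>count_space (offspring (N [] \<omega>)) \<partial>M)"
    by (intro nn_integral_cong) auto
  finally show ?thesis .
qed

lemma measurable_nn_integral_level:
  assumes [measurable]: "g \<in> borel_measurable borel"
  shows "(\<lambda>\<omega>. \<integral>\<^sup>+ i. g (tree_weight N C i \<omega>) \<partial>count_space (level n)) \<in> borel_measurable M"
proof -
  interpret L: sigma_finite_measure "count_space (level n)"
    by (intro sigma_finite_measure_count_space_countable) simp
  have "(\<lambda>(\<omega>, i). tree_weight N C i \<omega>) \<in> borel_measurable (M \<Otimes>\<^sub>M count_space (level n))"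
    using measurable_pair_swap[OF measurable_tree_weight_pair[of n]] by (simp add: split_beta')
  then have "(\<lambda>p. g (case p of (\<omega>, i) \<Rightarrow> tree_weight N C i \<omega>)) \<in> borel_measurable (M \<Otimes>\<^sub>M count_space (level n))"
    by measurable
  then show ?thesis
    by (intro L.borel_measurable_nn_integral) (simp add: split_beta')
qed

end

section \<open>Matrix convolution\<close>

lemma sets_mat_conv_power:
  assumes "\<And>i j. sets (F $ i $ j) = sets borel"
  shows "sets (mat_conv_power F n $ i $ j) = sets borel"
  using assms by (cases "(F, n)" rule: mat_conv_power.cases) (auto simp: mat_conv_def)

lemma row_times_first:
  fixes F :: "real measure ^ 2 ^ 2"
  assumes "\<And>i. sets (F $ i $ j) = sets borel"
  shows "row_times (vector [1, 0]) F $ j = F $ 1 $ j"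
proof (rule measure_eqI)
  fix B assume "B \<in> sets (row_times (vector [1, 0]) F $ j)"
  then show "emeasure (row_times (vector [1, 0]) F $ j) B = emeasure (F $ 1 $ j) B"
    using assms by (simp add: row_times_def emeasure_sum_measure sum_2 vector_2)
qed (simp add: row_times_def assms)

context weighted_branching_tree
begin

text \<open>
  The power \<open>\<^bold>H\<^sup>*\<^sup>(\<^sup>n\<^sup>+\<^sup>1\<^sup>) = \<^bold>H\<^sup>*\<^sup>n * \<^bold>H\<close> multiplies from the right, so the first row obeys a recursion of
  its own. Row \<open>2\<close> of \<open>\<^bold>H\<close> interchanges \<open>\<eta>\<^sub>+\<close> and \<open>\<eta>\<^sub>-\<close>, which matches the sign rule of
  \<open>signed_log_mult\<close>.
\<close>

lemma mat_conv_power_first_row: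
  fixes j :: 2
  assumes prob: "prob_space (tilted_law M N C \<alpha> 1)"
    and H: "H = (\<chi> i j. if i = j then mu M N C \<alpha> 1 1 else mu M N C \<alpha> (-1) 1)"
  shows "mat_conv_power H n $ 1 $ j = mu M N C \<alpha> (if j = 1 then 1 else - 1) n"
proof (cases n)
  case 0
  show ?thesis
  proof (rule measure_eqI)
    fix B assume "B \<in> sets (mat_conv_power H n $ 1 $ j)"
    then have "B \<in> sets borel" by (simp add: 0 split: if_splits)
    then show "emeasure (mat_conv_power H n $ 1 $ j) B = emeasure (mu M N C \<alpha> (if j = 1 then 1 else - 1) n) B"
      by (auto simp: 0 mu_eq_signed_log tilted_law_0 emeasure_signed_log nn_integral_return split: split_indicator)
  qed (simp add: 0 mu_def)
next
  case (Suc m)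
  have "mat_conv_power H (Suc m) $ 1 $ j = mu M N C \<alpha> (if j = 1 then 1 else - 1) (Suc m)" for j :: 2
  proof (induction m arbitrary: j)
    case 0
    show ?case by (auto simp: H)
  next
    case (Suc m)
    let ?s = "if j = 1 then 1 else - 1 :: real"
    have fin: "finite_measure (tilted_law M N C \<alpha> k)" for k
      using prob_space_tilted_law[OF prob, of k] by (simp add: prob_space_def)
    have H_nth: "H $ k $ l = (if k = l then mu M N C \<alpha> 1 1 else mu M N C \<alpha> (-1) 1)" for k l
      by (simp add: H)
    have nz: "1 \<noteq> (0::real)" "- 1 \<noteq> (0::real)" "?s \<noteq> 0" "- ?s \<noteq> 0"
      by simp_all
    have sf: "sigma_finite_measure (tilted_law M N C \<alpha> 1)"
      using fin[of 1] by (simp add: finite_measure_def)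
    show ?case
    proof (rule measure_eqI)
      fix B assume "B \<in> sets (mat_conv_power H (Suc (Suc m)) $ 1 $ j)"
      then have B: "B \<in> sets borel" by (simp add: mat_conv_def)
      have "emeasure (mat_conv_power H (Suc (Suc m)) $ 1 $ j) B =
          emeasure (mu M N C \<alpha> 1 (Suc m) \<star> mu M N C \<alpha> ?s 1) B +
          emeasure (mu M N C \<alpha> (- 1) (Suc m) \<star> mu M N C \<alpha> (- ?s) 1) B"
        using B exhaust_2[of j] by (auto simp: mat_conv_def emeasure_sum_measure sum_2 Suc.IH H_nth)
      also have "\<dots> = emeasure (signed_log (tilted_law M N C \<alpha> (Suc (Suc m))) ?s) B"
        unfolding nz[THEN mu_eq_signed_log]
        by (rule signed_log_mult[symmetric])
           (rule fin | rule nn_integral_tilted_law_Suc[OF _ sf] | simp add: B)+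
      also have "\<dots> = emeasure (mu M N C \<alpha> ?s (Suc (Suc m))) B"
        by (simp add: mu_eq_signed_log)
      finally show "emeasure (mat_conv_power H (Suc (Suc m)) $ 1 $ j) B =
          emeasure (mu M N C \<alpha> ?s (Suc (Suc m))) B" .
    qed (simp add: mat_conv_def mu_def)
  qed
  then show ?thesis by (simp add: Suc)
qed

end

section \<open>Mass and mean of the first generation, and the matrix identity\<close>

theorem lemma3p3:
  fixes M :: "'a measure"
    and N :: "nat list \<Rightarrow> 'a \<Rightarrow> enat"
    and C :: "nat list \<Rightarrow> 'a \<Rightarrow> real"
    and \<alpha> :: real
    and eta_plus eta_minus :: "real measure"
    and H :: "real measure ^ 2 ^ 2"
    and L :: "'a \<Rightarrow> nat \<Rightarrow> real"
  assumes tree: "weighted_branching_tree M N C"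
    and alpha: "\<alpha> > 0"
    and eta_plus: "eta_plus = mu M N C \<alpha> 1 1"
    and eta_minus: "eta_minus = mu M N C \<alpha> (-1) 1"
    and H: "H = (\<chi> i j. if i = j then eta_plus else eta_minus)"
    and L: "L = (\<lambda>\<omega> j. \<bar>C [j] \<omega>\<bar> powr \<alpha> * ln \<bar>C [j] \<omega>\<bar>)"
    and log_moment_exists:
      "(\<integral>\<^sup>+ \<omega>. (\<integral>\<^sup>+ j. ennreal (L \<omega> j) \<partial>count_space (offspring (N [] \<omega>))) \<partial>M) < \<infinity> \<or>
       (\<integral>\<^sup>+ \<omega>. (\<integral>\<^sup>+ j. ennreal (- L \<omega> j) \<partial>count_space (offspring (N [] \<omega>))) \<partial>M) < \<infinity>"
    and log_moment_nonneg:
      "ext_integral M (\<lambda>\<omega>. ext_integral (count_space (offspring (N [] \<omega>))) (\<lambda>j. ereal (L \<omega> j))) \<ge> 0"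
    and moment_one:
      "(\<integral>\<^sup>+ \<omega>. (\<integral>\<^sup>+ j. ennreal (\<bar>C [j] \<omega>\<bar> powr \<alpha>) \<partial>count_space (offspring (N [] \<omega>))) \<partial>M) = 1"
  shows "real_distribution (add_measure eta_plus eta_minus) \<and>
    emeasure (add_measure (mu_ext M N C \<alpha> 1 1) (mu_ext M N C \<alpha> (-1) 1)) {-\<infinity>} = 0 \<and>
    ext_integrable eta_plus ereal \<and> ext_integrable eta_minus ereal \<and>
    ext_integrable (add_measure eta_plus eta_minus) ereal \<and>
    ext_integral (add_measure eta_plus eta_minus) ereal =
      ext_integral eta_plus ereal + ext_integral eta_minus ereal \<and>
    ext_integral eta_plus ereal + ext_integral eta_minus ereal =
      ext_integral M (\<lambda>\<omega>. ext_integral (count_space (offspring (N [] \<omega>))) (\<lambda>j. ereal (L \<omega> j))) \<and>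
    (\<forall>n. (\<chi> j. if j = 1 then mu M N C \<alpha> 1 n else mu M N C \<alpha> (-1) n) =
      row_times (vector [1, 0]) (mat_conv_power H n))"
proof -
  interpret weighted_branching_tree M N C by (rule tree)
  let ?O = "\<lambda>\<omega>. count_space (offspring (N [] \<omega>))"
  let ?mean = "ext_integral M (\<lambda>\<omega>. ext_integral (?O \<omega>) (\<lambda>j. ereal (L \<omega> j)))"
  define A where "A = (\<integral>\<^sup>+ \<omega>. \<integral>\<^sup>+ j. ennreal (L \<omega> j) \<partial>?O \<omega> \<partial>M)"
  define B where "B = (\<integral>\<^sup>+ \<omega>. \<integral>\<^sup>+ j. ennreal (- L \<omega> j) \<partial>?O \<omega> \<partial>M)"
  have fin: "A < \<infinity> \<or> B < \<infinity>"
    using log_moment_exists by (simp add: A_def B_def)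
  have sets_eta [simp, measurable_cong]: "sets eta_plus = sets borel" "sets eta_minus = sets borel"
    by (simp_all add: eta_plus eta_minus mu_def)
  have prob: "prob_space (tilted_law M N C \<alpha> 1)"
    using nn_integral_tilted_law_offspring[of "\<lambda>_. 1" \<alpha>] moment_one
    by (intro prob_spaceI) simp

  have total: "emeasure (add_measure eta_plus eta_minus) UNIV = 1"
    using nn_integral_mu_1[of "\<lambda>_. 1" \<alpha>] moment_one
    by (simp add: emeasure_add_measure eta_plus eta_minus mu_def)
  then have dist: "real_distribution (add_measure eta_plus eta_minus)"
    by (intro real_distribution.intro real_distribution_axioms.intro prob_spaceI) simp_all
  have minf: "emeasure (add_measure (mu_ext M N C \<alpha> 1 1) (mu_ext M N C \<alpha> (-1) 1)) {-\<infinity>} = 0"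
    by (simp add: emeasure_add_measure emeasure_mu_ext_minf)

  define p p' q q' where
    "p = (\<integral>\<^sup>+ t. ennreal t \<partial>eta_plus)" and "p' = (\<integral>\<^sup>+ t. ennreal t \<partial>eta_minus)" and
    "q = (\<integral>\<^sup>+ t. ennreal (- t) \<partial>eta_plus)" and "q' = (\<integral>\<^sup>+ t. ennreal (- t) \<partial>eta_minus)"
  have pA: "p + p' = A"
    using nn_integral_mu_1[of ennreal \<alpha>]
    by (simp add: p_def p'_def A_def eta_plus eta_minus L ennreal_mult')
  have qB: "q + q' = B"
    using nn_integral_mu_1[of "\<lambda>t. ennreal (- t)" \<alpha>]
    by (simp add: q_def q'_def B_def eta_plus eta_minus L ennreal_mult'[symmetric])
  have int_eta: "ext_integral eta_plus ereal = enn2ereal p - enn2ereal q"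
    "ext_integral eta_minus ereal = enn2ereal p' - enn2ereal q'"
    by (simp_all add: ext_integral_def p_def p'_def q_def q'_def)
  have int_A: "(\<integral>\<^sup>+ t. ennreal t \<partial>add_measure eta_plus eta_minus) = A"
    unfolding pA[symmetric] p_def p'_def by (rule nn_integral_add_measure) simp_all
  have int_B: "(\<integral>\<^sup>+ t. ennreal (- t) \<partial>add_measure eta_plus eta_minus) = B"
    unfolding qB[symmetric] q_def q'_def by (rule nn_integral_add_measure) simp_all
  have int_sum: "ext_integral (add_measure eta_plus eta_minus) ereal = enn2ereal A - enn2ereal B"
    by (simp add: ext_integral_def int_A int_B)
  have add: "enn2ereal A - enn2ereal B = ext_integral eta_plus ereal + ext_integral eta_minus ereal"
    using fin unfolding int_eta pA[symmetric] qB[symmetric]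
    by (cases p; cases p'; cases q; cases q') (auto simp: ennreal_plus[symmetric] simp del: ennreal_plus)
  have integrable: "ext_integrable eta_plus ereal" "ext_integrable eta_minus ereal"
    "ext_integrable (add_measure eta_plus eta_minus) ereal"
  proof -
    have "ereal \<in> borel_measurable eta_plus" "ereal \<in> borel_measurable eta_minus"
      "ereal \<in> borel_measurable (add_measure eta_plus eta_minus)"
      by measurable
    moreover have "p < \<infinity> \<and> p' < \<infinity> \<or> q < \<infinity> \<and> q' < \<infinity>"
      using fin unfolding pA[symmetric] qB[symmetric] by simp
    ultimately show "ext_integrable eta_plus ereal" "ext_integrable eta_minus ereal"
      "ext_integrable (add_measure eta_plus eta_minus) ereal"
      unfolding ext_integrable_def uminus_ereal.simps e2ennreal_ereal int_A int_B
        p_def[symmetric] p'_def[symmetric] q_def[symmetric] q'_def[symmetric]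
      using fin by blast+
  qed

  have mean: "?mean = enn2ereal A - enn2ereal B"
  proof -
    let ?l = "\<lambda>x::real. \<bar>x\<bar> powr \<alpha> * ln \<bar>x\<bar>"
    let ?a = "\<lambda>\<omega>. \<integral>\<^sup>+ i. ennreal (?l (tree_weight N C i \<omega>)) \<partial>count_space (level 1)"
    let ?b = "\<lambda>\<omega>. \<integral>\<^sup>+ i. ennreal (- ?l (tree_weight N C i \<omega>)) \<partial>count_space (level 1)"
    have a: "(\<integral>\<^sup>+ j. ennreal (L \<omega> j) \<partial>?O \<omega>) = ?a \<omega>" for \<omega>
      using nn_integral_offspring[where g = "\<lambda>x. ennreal (?l x)" and N = N and C = C] by (simp add: L)
    have b: "(\<integral>\<^sup>+ j. ennreal (- L \<omega> j) \<partial>?O \<omega>) = ?b \<omega>" for \<omega>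
      using nn_integral_offspring[where g = "\<lambda>x. ennreal (- ?l x)" and N = N and C = C] by (simp add: L)
    have "?mean = ext_integral M (\<lambda>\<omega>. enn2ereal (?a \<omega>) - enn2ereal (?b \<omega>))"
      by (simp add: ext_integral_def[of "?O _"] a b)
    also have "\<dots> = enn2ereal A - enn2ereal B"
      using fin unfolding A_def B_def a b
      by (intro ext_integral_diff measurable_nn_integral_level) auto
    finally show ?thesis .
  qed

  have sets_H: "sets (H $ i $ j) = sets borel" for i j
    by (simp add: H)
  have "(\<chi> j. if j = 1 then mu M N C \<alpha> 1 n else mu M N C \<alpha> (-1) n) =
      row_times (vector [1, 0]) (mat_conv_power H n)" for n
    using mat_conv_power_first_row[OF prob H[unfolded eta_plus eta_minus], where n = n]
    by (simp add: vec_eq_iff row_times_first sets_mat_conv_power sets_H)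
  with dist minf integrable int_sum add mean show ?thesis
    by simp
qed

end
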